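(* Let $a,b>0$, put $\alpha=a-1$, $\beta=b-1$, let $\mu\in\mathcal{P}_1(\alpha,\beta)$ and let $n>1$. A flow field generated by a Jacobi set of sources, with complex potential $$\Upsilon(z)=\sum_{i=1}^{n-1}\log(z-w_i)+a\log(z-1)+b\log(z+1),$$ and with preassigned stagnation points at the zeros $x_1,\dots,x_n$ of the $n$th orthogonal polynomial $L_n$ with respect to $\mu$, has its source points of unitary strength $w_1,\dots,w_{n-1}$ located at the critical points of the $n$th orthogonal polynomial $Q_n$ with respect to $(\mathcal{L}^{(\alpha,\beta)},\mu)$.
   Context: $d\mu_{\alpha,\beta}(x)=(1-x)^\alpha(1+x)^\beta dx$ on $[-1,1]$; $\mathcal{L}^{(\alpha,\beta)}[f]=(1-x^2)f''+(\beta-\alpha-(\alpha+\beta+2)x)f'$; $\lambda_n=-n(1+n+\alpha+\beta)$. The class $\mathcal{P}_1(\alpha,\beta)$ consists of the finite positive Borel measures $\mu$ supported on $[-1,1]$ for which there is a polynomial $\rho$ of degree $1$, nonnegative on $[-1,1]$, with $d\mu(x)=\rho^{-1}(x)\,d\mu_{\alpha,\beta}(x)$. $L_n$ is the $n$th monic orthogonal polynomial with respect to $\mu$. The $n$th monic orthogonal polynomial with respect to $(\mathcal{L}^{(\alpha,\beta)},\mu)$ is the monic polynomial $Q_n$ of degree $n$, unique up to an additive constant, with $\mathcal{L}^{(\alpha,\beta)}[Q_n]=\lambda_nL_n$; its critical points (zeros of $Q_n'$) do not depend on the constant. A flow field generated by a Jacobi set of sources is a flow of an incompressible fluid in the complex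 plane due to $n-1$ source points of unitary strength at $w_1,\dots,w_{n-1}$ and two additional source points at $1$ and $-1$ of strengths $a>0$ and $b>0$ respectively. The complex velocity is $\mathcal{V}(z)=\Upsilon'(z)$, and the stagnation points are the zeros of $\mathcal{V}$, i.e. the points where the fluid has zero velocity. *)

theory Defs
  imports
    "HOL-Analysis.Analysis"
    "HOL-Complex_Analysis.Complex_Analysis"
    "HOL-Computational_Algebra.Computational_Algebra"
begin

definition jacobi_measure :: "real \<Rightarrow> real \<Rightarrow> real measure" where
  "jacobi_measure \<alpha> \<beta> =
     density lborel (\<lambda>x. ennreal (indicator {-1..1} x * ((1 - x) powr \<alpha> * (1 + x) powr \<beta>)))"

definition jacobi_op :: "real \<Rightarrow> real \<Rightarrow> real poly \<Rightarrow> real poly" where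
  "jacobi_op \<alpha> \<beta> f =
     [:1, 0, -1:] * pderiv (pderiv f) + [:\<beta> - \<alpha>, - (\<alpha> + \<beta> + 2):] * pderiv f"

definition jacobi_eigenvalue :: "real \<Rightarrow> real \<Rightarrow> nat \<Rightarrow> real" where
  "jacobi_eigenvalue \<alpha> \<beta> n = - real n * (1 + real n + \<alpha> + \<beta>)"

(* A zero of \<rho> can only be an endpoint of [-1,1], hence a null point of the Jacobi
   measure, so the value of 1 / 0 is irrelevant; finiteness of \<mu> is then a real restriction. *)
definition class_P1 :: "real \<Rightarrow> real \<Rightarrow> real measure set" where
  "class_P1 \<alpha> \<beta> = {\<mu>. finite_measure \<mu> \<and> sets \<mu> = sets borel \<and> emeasure \<mu> (- {-1..1}) = 0 \<and>
     (\<exists>\<rho> :: real poly. degree \<rho> = 1 \<and> (\<forall>x\<in>{-1..1}. poly \<rho> x \<ge> 0) \<and>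
        \<mu> = density (jacobi_measure \<alpha> \<beta>) (\<lambda>x. ennreal (1 / poly \<rho> x)))}"

definition monic_orthogonal_poly :: "real measure \<Rightarrow> nat \<Rightarrow> real poly \<Rightarrow> bool" where
  "monic_orthogonal_poly \<mu> n L \<longleftrightarrow> degree L = n \<and> lead_coeff L = 1 \<and>
     (\<forall>k<n. (LINT x|\<mu>. poly L x * x ^ k) = 0)"

(* Q is determined only up to an additive constant. *)
definition monic_orthogonal_poly_op ::
    "real \<Rightarrow> real \<Rightarrow> real measure \<Rightarrow> nat \<Rightarrow> real poly \<Rightarrow> bool" where
  "monic_orthogonal_poly_op \<alpha> \<beta> \<mu> n Q \<longleftrightarrow> degree Q = n \<and> lead_coeff Q = 1 \<and>
     (\<exists>L. monic_orthogonal_poly \<mu> n L \<and>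
        jacobi_op \<alpha> \<beta> Q = smult (jacobi_eigenvalue \<alpha> \<beta> n) L)"

definition log_branch :: "complex \<Rightarrow> complex set \<Rightarrow> (complex \<Rightarrow> complex) \<Rightarrow> bool" where
  "log_branch c U l \<longleftrightarrow> l holomorphic_on U \<and> (\<forall>z\<in>U. exp (l z) = z - c)"

(* The complex potential is multivalued, and the principal branches of its logarithms are
   discontinuous on real half-lines that contain (-1,1); so it is represented by the family of
   its holomorphic branches. The sources of unitary strength are w 1, ..., w (n - 1). *)
definition jacobi_potential_branch ::
    "real \<Rightarrow> real \<Rightarrow> nat \<Rightarrow> (nat \<Rightarrow> complex) \<Rightarrow> complex set \<Rightarrow> (complex \<Rightarrow> complex) \<Rightarrow> bool" where
  "jacobi_potential_branch a b n w U \<Upsilon> \<longleftrightarrow>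
     (\<exists>l lp lm. (\<forall>i\<in>{1..n-1}. log_branch (w i) U (l i)) \<and>
        log_branch 1 U lp \<and> log_branch (-1) U lm \<and>
        (\<forall>z\<in>U. \<Upsilon> z = (\<Sum>i=1..n-1. l i z) + of_real a * lp z + of_real b * lm z))"

(* The derivative does not depend on the branch; no branch exists around a source. *)
definition has_complex_velocity ::
    "real \<Rightarrow> real \<Rightarrow> nat \<Rightarrow> (nat \<Rightarrow> complex) \<Rightarrow> complex \<Rightarrow> complex \<Rightarrow> bool" where
  "has_complex_velocity a b n w z v \<longleftrightarrow>
     (\<exists>U \<Upsilon>. open U \<and> z \<in> U \<and> jacobi_potential_branch a b n w U \<Upsilon> \<and>
        (\<Upsilon> has_field_derivative v) (at z))"

definition stagnation_points :: "real \<Rightarrow> real \<Rightarrow> nat \<Rightarrow> (nat \<Rightarrow> complex) \<Rightarrow> complex set" where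
  "stagnation_points a b n w = {z. has_complex_velocity a b n w z 0}"

end

theory Submission
  imports Defs
begin

text \<open>
  Put \<open>W(z) = (z - w\<^sub>1) \<cdots> (z - w\<^sub>n\<^sub>-\<^sub>1)\<close>. Clearing denominators in \<open>\<V>(z) = 0\<close> shows that the polynomial
  \<open>D W = (1 - z\<^sup>2) W' + (b - a - (a + b) z) W\<close>, of degree \<open>n\<close>, vanishes at the zeros of \<open>L\<close>. These are
  \<open>n\<close> distinct points, so \<open>D W\<close> is a multiple of \<open>L\<close>, the factor being \<open>\<lambda>\<^sub>n/n\<close>. Since the Jacobi
  operator is \<open>\<L>[f] = D f'\<close>, also \<open>D Q'\<close> is \<open>\<lambda>\<^sub>n L\<close>; and \<open>D\<close> is injective on polynomials because it
  multiplies leading coefficients by \<open>-(d + a + b) \<noteq> 0\<close>. Hence \<open>Q' = n W\<close>.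
\<close>

section \<open>Orthogonal polynomials for a measure in the class\<close>

lemma AE_class_P1_bounded:
  assumes "\<mu> \<in> class_P1 \<alpha> \<beta>"
  shows "AE x in \<mu>. x \<in> {-1..1}"
proof -
  have "- {-1..1::real} \<in> null_sets \<mu>"
    using assms by (auto simp: class_P1_def null_sets_def)
  from AE_not_in[OF this] show ?thesis by simp
qed

text \<open>A continuous function is bounded on the compact interval that carries the finite
  measure. Linearity below depends on this, since a non-integrable function has integral 0 by
  default.\<close>

lemma integrable_class_P1:
  fixes f :: "real \<Rightarrow> real"
  assumes \<mu>: "\<mu> \<in> class_P1 \<alpha> \<beta>" and f: "continuous_on UNIV f"
  shows "integrable \<mu> f"
proof -
  have sets[measurable_cong]: "sets \<mu> = sets borel" and "finite_measure \<mu>"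
    using \<mu> by (auto simp: class_P1_def)
  interpret finite_measure \<mu> by fact
  have "compact (f ` {-1..1})"
    using f by (intro compact_continuous_image continuous_on_subset[OF f]) auto
  then obtain B where B: "\<And>x. x \<in> {-1..1} \<Longrightarrow> norm (f x) \<le> B"
    by (meson bounded_iff compact_imp_bounded imageI)
  show ?thesis
  proof (rule integrable_const_bound)
    show "AE x in \<mu>. norm (f x) \<le> B"
      using AE_class_P1_bounded[OF \<mu>] by eventually_elim (use B in auto)
    show "f \<in> borel_measurable \<mu>"
      using borel_measurable_continuous_onI[OF f] measurable_cong_sets[OF sets refl] by blast
  qed
qed

lemma integrable_class_P1_poly:
  "\<mu> \<in> class_P1 \<alpha> \<beta> \<Longrightarrow> integrable \<mu> (\<lambda>x. poly p x)"
  by (rule integrable_class_P1) (auto intro!: continuous_intros)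

text \<open>The density is positive on (-1,1) off the root of \<open>\<rho>\<close>, so vanishing
  almost everywhere would confine almost all of (-1,1) to finitely many roots.\<close>

lemma not_AE_root_class_P1:
  assumes \<mu>: "\<mu> \<in> class_P1 \<alpha> \<beta>" and p: "p \<noteq> 0"
  shows "\<not> (AE x in \<mu>. poly p x = 0)"
proof
  assume AE: "AE x in \<mu>. poly p x = 0"
  from \<mu> obtain \<rho> where deg: "degree \<rho> = 1" and nonneg: "\<forall>x\<in>{-1..1}. poly \<rho> x \<ge> 0"
    and eq: "\<mu> = density (jacobi_measure \<alpha> \<beta>) (\<lambda>x. ennreal (1 / poly \<rho> x))"
    by (auto simp: class_P1_def)
  have [measurable]: "(\<lambda>x. poly q x) \<in> borel_measurable borel" for q :: "real poly"
    by (intro borel_measurable_continuous_onI continuous_intros)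
  \<comment> \<open>At a root of \<open>\<rho>\<close> the density is \<open>1 / 0 = 0\<close> and
    gives no information, hence the guard.\<close>
  have "AE x in lborel. x \<in> {-1<..<1} \<longrightarrow> poly \<rho> x \<noteq> 0 \<longrightarrow> poly p x = 0"
  proof -
    have "AE x in jacobi_measure \<alpha> \<beta>. ennreal (1 / poly \<rho> x) > 0 \<longrightarrow> poly p x = 0"
      using AE unfolding eq by (subst (asm) AE_density) (auto simp: jacobi_measure_def)
    then have "AE x in lborel.
      0 < ennreal (indicator {-1..1} x * ((1 - x) powr \<alpha> * (1 + x) powr \<beta>)) \<longrightarrow>
      ennreal (1 / poly \<rho> x) > 0 \<longrightarrow> poly p x = 0"
      unfolding jacobi_measure_def by (subst (asm) AE_density) auto
    then show ?thesis
    proof eventually_elim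
      case (elim x)
      show ?case
      proof (intro impI)
        assume x: "x \<in> {-1<..<1}" and \<rho>x: "poly \<rho> x \<noteq> 0"
        then have "poly \<rho> x > 0"
          using nonneg by (simp add: less_le)
        then show "poly p x = 0"
          using elim x by (auto simp: indicator_def)
      qed
    qed
  qed
  moreover have "AE x in lborel. x \<notin> {x. poly (\<rho> * p) x = 0}"
  proof (rule AE_not_in)
    have "finite {x. poly (\<rho> * p) x = 0}"
      using deg p by (intro poly_roots_finite) auto
    then show "{x. poly (\<rho> * p) x = 0} \<in> null_sets lborel"
      by (rule finite_imp_null_set_lborel)
  qed
  ultimately have "AE x in lborel. x \<notin> {-1<..<1::real}"
    by eventually_elim auto
  then have "{-1<..<1::real} \<in> null_sets lborel"
    by (subst (asm) AE_iff_null_sets[symmetric]) auto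
  then show False
    by (simp add: null_sets_def)
qed

text \<open>Definiteness of the inner product, applied below to squares and to squares times a
  nonnegative weight.\<close>

lemma integral_class_P1_eq_0_imp:
  assumes \<mu>: "\<mu> \<in> class_P1 \<alpha> \<beta>" and nonneg: "\<And>x. poly p x \<ge> 0"
    and int: "(LINT x|\<mu>. poly p x) = 0"
  shows "p = 0"
proof (rule ccontr)
  assume "p \<noteq> 0"
  have "AE x in \<mu>. poly p x = 0"
    using int integral_nonneg_eq_0_iff_AE[OF integrable_class_P1_poly[OF \<mu>, of p]] nonneg by auto
  with not_AE_root_class_P1[OF \<mu> \<open>p \<noteq> 0\<close>] show False ..
qed

lemma monic_orthogonal_poly_integral_eq_0:
  assumes \<mu>: "\<mu> \<in> class_P1 \<alpha> \<beta>" and L: "monic_orthogonal_poly \<mu> n L" and M: "degree M < n"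
  shows "(LINT x|\<mu>. poly (L * M) x) = 0"
proof -
  have "poly (L * M) x = (\<Sum>k\<le>degree M. coeff M k * (poly L x * x ^ k))" for x
    by (simp add: poly_altdef[of M] sum_distrib_left algebra_simps)
  moreover have "integrable \<mu> (\<lambda>x. poly L x * x ^ k)" for k
    by (rule integrable_class_P1[OF \<mu>]) (auto intro!: continuous_intros)
  ultimately have "(LINT x|\<mu>. poly (L * M) x) =
      (\<Sum>k\<le>degree M. coeff M k * (LINT x|\<mu>. poly L x * x ^ k))"
    by (simp add: Bochner_Integration.integral_sum)
  also have "\<dots> = 0"
    using L M by (intro sum.neutral) (auto simp: monic_orthogonal_poly_def)
  finally show ?thesis .
qed

text \<open>The leading terms cancel in \<open>D = L - L'\<close>, so both \<open>L\<close> and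
  \<open>L'\<close> are orthogonal to \<open>D\<close>, and the integral of \<open>D * D\<close>
  vanishes.\<close>

lemma monic_orthogonal_poly_unique:
  assumes \<mu>: "\<mu> \<in> class_P1 \<alpha> \<beta>"
    and L: "monic_orthogonal_poly \<mu> n L" and L': "monic_orthogonal_poly \<mu> n L'"
  shows "L = L'"
proof (rule ccontr)
  assume neq: "L \<noteq> L'"
  define D where "D = L - L'"
  have "degree D \<le> n" "coeff D n = 0"
    using L L' degree_diff_le[of L n L'] by (auto simp: D_def monic_orthogonal_poly_def)
  moreover have "D \<noteq> 0"
    using neq by (simp add: D_def)
  ultimately have "degree D < n"
    by (metis leading_coeff_0_iff le_neq_implies_less)
  then have "0 = (LINT x|\<mu>. poly (L * D) x) - (LINT x|\<mu>. poly (L' * D) x)"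
    using monic_orthogonal_poly_integral_eq_0[OF \<mu>] L L' by simp
  also have "(LINT x|\<mu>. poly (L * D) x) - (LINT x|\<mu>. poly (L' * D) x) =
      (LINT x|\<mu>. poly (L * D) x - poly (L' * D) x)"
    by (intro Bochner_Integration.integral_diff[symmetric] integrable_class_P1_poly[OF \<mu>])
  also have "(\<lambda>x. poly (L * D) x - poly (L' * D) x) = poly (D * D)"
    by (simp add: D_def fun_eq_iff algebra_simps)
  finally have "D * D = 0"
    by (intro integral_class_P1_eq_0_imp[OF \<mu>]) simp_all
  with \<open>D \<noteq> 0\<close> show False by simp
qed

text \<open>If \<open>L = q * M\<close>, then \<open>M\<close> has degree below \<open>n\<close>,
  and orthogonality of \<open>L\<close> to \<open>M\<close> says that \<open>q * M * M\<close> has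
  integral 0.\<close>

lemma monic_orthogonal_poly_no_nonneg_factor:
  assumes \<mu>: "\<mu> \<in> class_P1 \<alpha> \<beta>" and L: "monic_orthogonal_poly \<mu> n L"
    and q: "degree q > 0" "\<And>x. poly q x \<ge> 0"
  shows "\<not> q dvd L"
proof
  assume "q dvd L"
  then obtain M where M: "L = q * M" ..
  have "L \<noteq> 0"
    using L by (auto simp: monic_orthogonal_poly_def)
  then have "q \<noteq> 0" "M \<noteq> 0"
    using M by auto
  then have "degree M < n"
    using L q M by (auto simp: monic_orthogonal_poly_def degree_mult_eq)
  then have "(LINT x|\<mu>. poly (q * (M * M)) x) = 0"
    using monic_orthogonal_poly_integral_eq_0[OF \<mu> L] by (simp add: M mult.assoc)
  then have "q * (M * M) = 0"
    by (rule integral_class_P1_eq_0_imp[OF \<mu>, rotated]) (simp add: q)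
  with \<open>q \<noteq> 0\<close> \<open>M \<noteq> 0\<close> show False by simp
qed

section \<open>Real polynomials as complex polynomials\<close>

abbreviation complex_poly :: "real poly \<Rightarrow> complex poly" where
  "complex_poly \<equiv> map_poly complex_of_real"

lemma complex_poly_add: "complex_poly (p + q) = complex_poly p + complex_poly q"
  by (rule poly_eqI) (simp add: coeff_map_poly)

lemma complex_poly_mult: "complex_poly (p * q) = complex_poly p * complex_poly q"
  by (rule poly_eqI) (simp add: coeff_map_poly coeff_mult)

lemma complex_poly_smult: "complex_poly (smult c p) = smult (of_real c) (complex_poly p)"
  by (rule poly_eqI) (simp add: coeff_map_poly)

lemma complex_poly_pderiv: "complex_poly (pderiv p) = pderiv (complex_poly p)"
  by (rule poly_eqI) (simp add: coeff_map_poly coeff_pderiv)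

lemma poly_complex_poly_of_real: "poly (complex_poly p) (of_real x) = of_real (poly p x)"
  by (induction p) (simp_all add: map_poly_pCons)

lemma degree_complex_poly [simp]: "degree (complex_poly p) = degree p"
  by (simp add: degree_map_poly)

text \<open>The quadratic is (x - z)(x - cnj z). The remainder modulo it is a real polynomial of
  degree at most 1 with a nonreal root, hence 0.\<close>

lemma nonreal_root_imp_quadratic_dvd:
  assumes root: "poly (complex_poly p) z = 0" and z: "Im z \<noteq> 0"
  shows "[:(Re z)\<^sup>2 + (Im z)\<^sup>2, - 2 * Re z, 1:] dvd p"
proof -
  define q where "q = [:(Re z)\<^sup>2 + (Im z)\<^sup>2, - 2 * Re z, 1:]"
  have qz: "poly (complex_poly q) z = 0"
    by (simp add: q_def map_poly_pCons complex_eq_iff power2_eq_square algebra_simps)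
  define r where "r = p mod q"
  have "complex_poly p = complex_poly (p div q) * complex_poly q + complex_poly r"
    unfolding r_def complex_poly_mult[symmetric] complex_poly_add[symmetric] by simp
  then have "poly (complex_poly r) z = 0"
    using root qz by simp
  moreover obtain c d where r: "r = [:c, d:]"
  proof -
    have "degree r < 2"
      using degree_mod_less[of q p] by (auto simp: r_def q_def)
    then have "r = [:coeff r 0, coeff r 1:]"
      by (intro poly_eqI) (auto simp: coeff_pCons coeff_eq_0 split: nat.splits)
    then show ?thesis using that by blast
  qed
  ultimately have "c = 0 \<and> d = 0"
    using z by (auto simp: map_poly_pCons complex_eq_iff)
  then have "p mod q = 0"
    using r by (simp add: r_def)
  then show ?thesis
    by (simp add: q_def dvd_eq_mod_eq_0)
qed

lemma double_root_imp_square_dvd: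
  fixes p :: "'a :: field_char_0 poly"
  assumes "poly p x = 0" "poly (pderiv p) x = 0"
  shows "[:- x, 1:] * [:- x, 1:] dvd p"
proof -
  from assms(1) obtain q where q: "p = [:- x, 1:] * q"
    by (auto simp: poly_eq_0_iff_dvd)
  have "poly q x = 0"
    using assms(2) by (simp add: q pderiv_mult pderiv_pCons del: mult_pCons_left)
  then have "[:- x, 1:] dvd q"
    by (simp add: poly_eq_0_iff_dvd)
  then show ?thesis
    unfolding q by (rule mult_dvd_mono[OF dvd_refl])
qed

text \<open>A nonreal root z would give the nonnegative factor |x - z|^2, a real multiple root x0
  the factor (x - x0)^2. This yields \<open>n\<close> distinct zeros for the interpolation
  argument.\<close>

lemma rsquarefree_monic_orthogonal_poly:
  assumes \<mu>: "\<mu> \<in> class_P1 \<alpha> \<beta>" and L: "monic_orthogonal_poly \<mu> n L"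
  shows "rsquarefree (complex_poly L)"
  unfolding rsquarefree_roots
proof (intro allI notI, elim conjE)
  fix z
  assume z: "poly (complex_poly L) z = 0" "poly (pderiv (complex_poly L)) z = 0"
  show False
  proof (cases "Im z = 0")
    case False
    define q where "q = [:(Re z)\<^sup>2 + (Im z)\<^sup>2, - 2 * Re z, 1:]"
    have "poly q x = (x - Re z)\<^sup>2 + (Im z)\<^sup>2" for x
      by (simp add: q_def power2_eq_square algebra_simps)
    then have "poly q x \<ge> 0" for x
      by simp
    moreover have "degree q > 0"
      by (simp add: q_def)
    moreover have "q dvd L"
      using nonreal_root_imp_quadratic_dvd[OF z(1) False] by (simp add: q_def)
    ultimately show False
      using monic_orthogonal_poly_no_nonneg_factor[OF \<mu> L] by blast
  next
    case True
    then obtain x where x: "z = of_real x"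
      by (metis complex_is_Real_iff Reals_cases)
    define q where "q = [:- x, 1:] * [:- x, 1:]"
    have "poly q y = (y - x)\<^sup>2" for y
      by (simp add: q_def power2_eq_square algebra_simps)
    then have "poly q y \<ge> 0" for y
      by simp
    moreover have "degree q > 0"
      by (simp add: q_def)
    moreover have "poly L x = 0" "poly (pderiv L) x = 0"
      using z by (simp_all add: x poly_complex_poly_of_real flip: complex_poly_pderiv)
    then have "q dvd L"
      unfolding q_def by (rule double_root_imp_square_dvd)
    ultimately show False
      using monic_orthogonal_poly_no_nonneg_factor[OF \<mu> L] by blast
  qed
qed

lemma card_roots_rsquarefree:
  fixes p :: "complex poly"
  assumes "rsquarefree p"
  shows "card {z. poly p z = 0} = degree p"
proof -
  have "p \<noteq> 0"
    using assms by (simp add: rsquarefree_def)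
  then have "degree p = degree (\<Prod>z|poly p z = 0. [:-z, 1:])"
    by (subst complex_poly_decompose_rsquarefree[OF assms, symmetric]) simp
  also have "\<dots> = card {z. poly p z = 0}"
    by (subst degree_prod_sum_eq) auto
  finally show ?thesis by simp
qed

section \<open>The first-order operator behind the Jacobi operator\<close>

text \<open>Polymorphic because it acts on the real \<open>pderiv Q\<close> and on the complex
  polynomial whose roots are the sources.\<close>

definition first_order_op :: "'a \<Rightarrow> 'a \<Rightarrow> 'a :: field_char_0 poly \<Rightarrow> 'a poly" where
  "first_order_op a b f = [:1, 0, -1:] * pderiv f + [:b - a, - (a + b):] * f"

lemma jacobi_op_eq_first_order_op:
  "jacobi_op (a - 1) (b - 1) f = first_order_op a b (pderiv f)"
  by (simp add: jacobi_op_def first_order_op_def)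

lemma complex_poly_first_order_op:
  "complex_poly (first_order_op a b f) = first_order_op (of_real a) (of_real b) (complex_poly f)"
  unfolding first_order_op_def complex_poly_add complex_poly_mult complex_poly_pderiv
  by (simp add: map_poly_pCons)

lemma first_order_op_diff:
  "first_order_op a b (f - g) = first_order_op a b f - first_order_op a b g"
  unfolding first_order_op_def pderiv_diff right_diff_distrib by (rule add_diff_add[symmetric])

lemma first_order_op_smult:
  "first_order_op a b (smult c f) = smult c (first_order_op a b f)"
  by (simp add: first_order_op_def pderiv_smult smult_add_right algebra_simps)

lemma coeff_first_order_op_Suc:
  "coeff (first_order_op a b f) (Suc k) =
     of_nat (k + 2) * coeff f (k + 2) + (b - a) * coeff f (k + 1) - (of_nat k + a + b) * coeff f k"
  by (cases k) (simp_all add: first_order_op_def coeff_pderiv algebra_simps)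

lemma degree_first_order_op_le: "degree (first_order_op a b f) \<le> Suc (degree f)"
proof (rule degree_le, intro allI impI)
  fix i
  assume "Suc (degree f) < i"
  then show "coeff (first_order_op a b f) i = 0"
    by (cases i) (simp_all add: coeff_first_order_op_Suc coeff_eq_0)
qed

lemma coeff_first_order_op_lead:
  "coeff (first_order_op a b f) (Suc (degree f)) = - (of_nat (degree f) + a + b) * lead_coeff f"
  by (simp add: coeff_first_order_op_Suc coeff_eq_0 algebra_simps)

text \<open>By linearity the operator kills \<open>f - g\<close>; its coefficient just above the
  degree of \<open>f - g\<close> is a nonzero multiple of the leading coefficient of
  \<open>f - g\<close>.\<close>

lemma first_order_op_inj:
  assumes ab: "\<And>k :: nat. of_nat k + a + b \<noteq> 0"
    and eq: "first_order_op a b f = first_order_op a b g"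
  shows "f = g"
proof -
  have "- (of_nat (degree (f - g)) + a + b) * lead_coeff (f - g) = 0"
    unfolding coeff_first_order_op_lead[symmetric] first_order_op_diff eq by simp
  then have "lead_coeff (f - g) = 0"
    unfolding mult_eq_0_iff neg_equal_0_iff_equal using ab by blast
  then show ?thesis
    by (simp only: leading_coeff_0_iff right_minus_eq)
qed

section \<open>The velocity of the flow\<close>

text \<open>Differentiate \<open>exp (l z) = z - c\<close> on the open set \<open>U\<close>.\<close>

lemma log_branch_has_field_derivative:
  assumes l: "log_branch c U l" and U: "open U" "z \<in> U"
  shows "(l has_field_derivative 1 / (z - c)) (at z)"
proof -
  have exp: "exp (l y) = y - c" if "y \<in> U" for y
    using l that by (simp add: log_branch_def)
  have l': "(l has_field_derivative deriv l z) (at z)"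
    using l U by (auto simp: log_branch_def intro: holomorphic_derivI)
  have "((\<lambda>y. exp (l y)) has_field_derivative exp (l z) * deriv l z) (at z)"
    by (rule derivative_eq_intros l' refl)+
  then have "((\<lambda>y. y - c) has_field_derivative (z - c) * deriv l z) (at z)"
    using U exp by (auto simp: exp intro: has_field_derivative_transform_within_open)
  moreover have "((\<lambda>y. y - c) has_field_derivative 1) (at z)"
    by (auto intro!: derivative_eq_intros)
  ultimately have "(z - c) * deriv l z = 1"
    by (rule DERIV_unique)
  \<comment> \<open>The product being 1 already forces \<open>z - c\<close> to be nonzero.\<close>
  then have "deriv l z = 1 / (z - c)"
    by (metis mult_zero_left nonzero_mult_div_cancel_left zero_neq_one)
  with l' show ?thesis by simp
qed

lemma log_branch_neq: "log_branch c U l \<Longrightarrow> z \<in> U \<Longrightarrow> z \<noteq> c"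
  by (metis exp_not_eq_zero log_branch_def right_minus_eq)

text \<open>\<open>exp\<close> has no zeros, so no branch is defined at a source. Every branch has
  the same derivative, which uniqueness of derivatives equates with 0.\<close>

lemma stagnation_pointsD:
  assumes "z \<in> stagnation_points a b n w"
  shows "\<forall>i\<in>{1..n-1}. z \<noteq> w i" "z \<noteq> 1" "z \<noteq> -1"
    "(\<Sum>i=1..n-1. 1 / (z - w i)) + of_real a / (z - 1) + of_real b / (z + 1) = 0"
proof -
  from assms obtain U \<Upsilon> l lp lm where U: "open U" "z \<in> U"
    and D: "(\<Upsilon> has_field_derivative 0) (at z)"
    and l: "\<And>i. i \<in> {1..n-1} \<Longrightarrow> log_branch (w i) U (l i)"
    and lp: "log_branch 1 U lp" and lm: "log_branch (-1) U lm"
    and \<Upsilon>: "\<And>z. z \<in> U \<Longrightarrow> \<Upsilon> z = (\<Sum>i=1..n-1. l i z) + of_real a * lp z + of_real b * lm z"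
    unfolding stagnation_points_def has_complex_velocity_def jacobi_potential_branch_def by blast
  show "\<forall>i\<in>{1..n-1}. z \<noteq> w i" "z \<noteq> 1" "z \<noteq> -1"
    using log_branch_neq[OF l U(2)] log_branch_neq[OF lp U(2)] log_branch_neq[OF lm U(2)] by auto
  have "((\<lambda>z. (\<Sum>i=1..n-1. l i z) + of_real a * lp z + of_real b * lm z) has_field_derivative
      (\<Sum>i=1..n-1. 1 / (z - w i)) + of_real a * (1 / (z - 1)) + of_real b * (1 / (z - -1))) (at z)"
    by (intro DERIV_add DERIV_cmult DERIV_sum log_branch_has_field_derivative[OF _ U] l lp lm)
  then have "(\<Upsilon> has_field_derivative
      (\<Sum>i=1..n-1. 1 / (z - w i)) + of_real a * (1 / (z - 1)) + of_real b * (1 / (z - -1))) (at z)"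
    by (rule has_field_derivative_transform_within_open[OF _ U]) (simp add: \<Upsilon>)
  from DERIV_unique[OF this D]
  show "(\<Sum>i=1..n-1. 1 / (z - w i)) + of_real a / (z - 1) + of_real b / (z + 1) = 0"
    by simp
qed

text \<open>Logarithmic differentiation of the product.\<close>

lemma poly_pderiv_prod_linear:
  fixes w :: "'i \<Rightarrow> 'a :: field_char_0"
  assumes "\<forall>i\<in>I. z \<noteq> w i"
  shows "poly (pderiv (\<Prod>i\<in>I. [:- w i, 1:])) z =
           poly (\<Prod>i\<in>I. [:- w i, 1:]) z * (\<Sum>i\<in>I. 1 / (z - w i))"
  using assms
  \<comment> \<open>For infinite \<open>I\<close> the product defaults to 1 and the sum to 0, so
    both sides are 0.\<close>
  by (induction I rule: infinite_finite_induct)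
     (simp_all add: pderiv_mult pderiv_pCons field_simps del: mult_pCons_left)

lemma first_order_op_stagnation:
  assumes "z \<in> stagnation_points a b n w"
  shows "poly (first_order_op (of_real a) (of_real b) (\<Prod>i=1..n-1. [:- w i, 1:])) z = 0"
proof -
  note z = stagnation_pointsD[OF assms]
  define W where "W = (\<Prod>i=1..n-1. [:- w i, 1:])"
  define S where "S = (\<Sum>i=1..n-1. 1 / (z - w i))"
  have "poly (first_order_op (of_real a) (of_real b) W) z =
      poly W z * ((1 - z\<^sup>2) * S + (of_real b - of_real a - (of_real a + of_real b) * z))"
    using poly_pderiv_prod_linear[OF z(1), folded W_def S_def]
    by (simp add: first_order_op_def power2_eq_square algebra_simps)
  \<comment> \<open>The bracket is (1 - z^2) times the velocity: the sources at 1 and -1 contribute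
    -a(z + 1) and -b(z - 1), whose sum is b - a - (a + b)z.\<close>
  also have "(1 - z\<^sup>2) * S + (of_real b - of_real a - (of_real a + of_real b) * z) =
      (1 - z\<^sup>2) * (S + of_real a / (z - 1) + of_real b / (z + 1))"
  proof -
    have "z - 1 \<noteq> 0" "z + 1 \<noteq> 0"
      using z(2,3) by (auto simp: add_eq_0_iff2)
    then have "(1 - z\<^sup>2) * (of_real a / (z - 1)) = - of_real a * (z + 1)"
      "(1 - z\<^sup>2) * (of_real b / (z + 1)) = - of_real b * (z - 1)"
      by (simp_all add: field_simps power2_eq_square)
    then show ?thesis
      unfolding distrib_left by (simp add: algebra_simps)
  qed
  also have "\<dots> = 0"
    using z(4) by (simp add: S_def)
  finally show ?thesis
    by (simp add: W_def)
qed

text \<open>Equality of multisets lets sources coincide and matches multiplicities of critical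
  points.\<close>

theorem mainTheorem12:
  fixes a b \<alpha> \<beta> :: real and \<mu> :: "real measure" and n :: nat
    and L Q :: "real poly" and w :: "nat \<Rightarrow> complex"
  assumes "a > 0" and "b > 0" and "\<alpha> = a - 1" and "\<beta> = b - 1"
    and "\<mu> \<in> class_P1 \<alpha> \<beta>" and "n > 1"
    and "monic_orthogonal_poly \<mu> n L"
    and "monic_orthogonal_poly_op \<alpha> \<beta> \<mu> n Q"
    and "{z. poly (map_poly complex_of_real L) z = 0} \<subseteq> stagnation_points a b n w"
  shows "image_mset w (mset_set {1..n-1}) = proots (pderiv (map_poly complex_of_real Q))"
proof -
  define W where "W = (\<Prod>i=1..n-1. [:- w i, 1:])"
  \<comment> \<open>This is the eigenvalue divided by \<open>n\<close>, and also the leading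
    coefficient of \<open>?D W\<close>, as \<open>W\<close> is monic of degree
    \<open>n - 1\<close>.\<close>
  define c where "c = - (real n - 1 + a + b)"
  let ?D = "first_order_op (complex_of_real a) (complex_of_real b)"
  have degL: "degree L = n" and monic: "coeff L n = 1"
    using assms(7) by (auto simp: monic_orthogonal_poly_def)
  have degW: "degree W = n - 1"
    unfolding W_def by (subst degree_prod_sum_eq) auto
  have lcW: "lead_coeff W = 1"
    unfolding W_def by (subst lead_coeff_prod) simp
  have "?D W = smult (of_real c) (complex_poly L)"
  \<comment> \<open>Both sides have degree at most \<open>n\<close> and the same coefficient at
    \<open>n\<close>, so agreement at the \<open>n\<close> distinct zeros of \<open>L\<close>
    suffices.\<close>
  proof (rule poly_eqI_degree_lead_coeff)
    show "coeff (?D W) n = coeff (smult (of_real c) (complex_poly L)) n"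
    proof -
      have "coeff (?D W) n = - (of_nat (n - 1) + of_real a + of_real b)"
        using coeff_first_order_op_lead[of "of_real a" "of_real b" W, unfolded lcW, unfolded degW]
          assms(6) by simp
      then show ?thesis
        using assms(6) by (simp add: c_def monic coeff_map_poly of_nat_diff)
    qed
    show "n \<le> card {z. poly (complex_poly L) z = 0}"
      using card_roots_rsquarefree[OF rsquarefree_monic_orthogonal_poly[OF assms(5,7)]] degL by simp
    show "degree (?D W) \<le> n"
      using degree_first_order_op_le[of "of_real a" "of_real b" W] degW assms(6) by simp
    show "degree (smult (of_real c) (complex_poly L)) \<le> n"
      using degree_smult_le[of "of_real c" "complex_poly L"] degL by simp
    show "poly (?D W) z = poly (smult (of_real c) (complex_poly L)) z"
      if "z \<in> {z. poly (complex_poly L) z = 0}" for z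
      using that first_order_op_stagnation[of z a b n w] assms(9) by (auto simp: W_def)
  qed
  \<comment> \<open>The factor \<open>n\<close> matches the leading coefficient of the derivative of
    the monic \<open>Q\<close>.\<close>
  then have "?D (smult (of_nat n) W) = smult (of_real (real n * c)) (complex_poly L)"
    by (simp add: first_order_op_smult)
  also have "\<dots> = ?D (pderiv (complex_poly Q))"
  proof -
    obtain L' where "monic_orthogonal_poly \<mu> n L'"
      and Q: "jacobi_op \<alpha> \<beta> Q = smult (jacobi_eigenvalue \<alpha> \<beta> n) L'"
      using assms(8) by (auto simp: monic_orthogonal_poly_op_def)
    \<comment> \<open>The definition of \<open>Q\<close> supplies its own orthogonal polynomial;
      uniqueness identifies it with the given one.\<close>
    then have "L' = L"
      using monic_orthogonal_poly_unique[OF assms(5)] assms(7) by blast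
    moreover have "jacobi_eigenvalue \<alpha> \<beta> n = real n * c"
      by (simp add: jacobi_eigenvalue_def c_def assms(3,4) algebra_simps)
    ultimately have "first_order_op a b (pderiv Q) = smult (real n * c) L"
      using Q by (simp add: assms(3,4) jacobi_op_eq_first_order_op)
    then have "complex_poly (first_order_op a b (pderiv Q)) = complex_poly (smult (real n * c) L)"
      by simp
    then show ?thesis
      by (simp only: complex_poly_first_order_op complex_poly_pderiv complex_poly_smult)
  qed
  finally have "smult (of_nat n) W = pderiv (complex_poly Q)"
  proof (rule first_order_op_inj[rotated])
    fix k :: nat
    \<comment> \<open>Positivity of \<open>k + a + b\<close> is an order argument, so it is made
      over the reals and transferred.\<close>
    have "complex_of_real (real k + a + b) \<noteq> 0"
      using assms(1,2) by (subst of_real_eq_0_iff) linarith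
    then show "of_nat k + complex_of_real a + complex_of_real b \<noteq> 0"
      by simp
  qed
  then have "proots (pderiv (complex_poly Q)) = proots W"
    using assms(6) by (metis gr_implies_not0 of_nat_eq_0_iff proots_smult)
  also have "\<dots> = (\<Sum>i=1..n-1. {#w i#})"
    unfolding W_def by (subst proots_prod) auto
  also have "\<dots> = image_mset w (mset_set {1..n-1})"
    by (simp add: sum_unfold_sum_mset)
  finally show ?thesis ..
qed

end
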